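(* If $\mathrm{st}$ is a statistic that is weakly shuffle-compatible on parking functions, then the shifted shuffle algebra $\mathcal{A}^{\mathrm{PF}}_{\mathrm{st}}$ is a quotient of $\mathrm{PQSym}$, i.e. isomorphic as a $\mathbb{Q}$-algebra to $\mathrm{PQSym}/I$ for some two-sided ideal $I$.
   Context: All algebras are over $\mathbb{Q}$. A parking function of length $n\ge0$ is a sequence $\alpha=(\alpha_1,\dots,\alpha_n)$ of positive integers whose weakly increasing rearrangement $\alpha'_1\le\dots\le\alpha'_n$ satisfies $\alpha'_i\le i$; $|\alpha|=n$. $\mathrm{PF}_n$ is the set of these and $\mathrm{PF}=\bigcup_{n\ge0}\mathrm{PF}_n$. For $\alpha\in\mathrm{PF}_n,\beta\in\mathrm{PF}_m$, the shifted shuffle $\overrightarrow{\mathrm{Sh}}(\alpha,\beta)$ is the set of all interleavings (shuffles) of $\alpha$ and $\beta[n]=(\beta_1+n,\dots,\beta_m+n)$. A statistic $\mathrm{st}$ on $\mathrm{PF}$ is weakly shuffle-compatible on parking functions if for all $\alpha,\beta\in\mathrm{PF}$ the multiset $\{\{\mathrm{st}(\gamma):\gamma\in\overrightarrow{\mathrm{Sh}}(\alpha,\beta)\}\}$ is determined by $|\alpha|,|\beta|,\mathrm{st}(\alpha),\mathrm{st}(\beta)$. Let $[\alpha]^{\mathrm{PF}}_{\mathrm{st}}=\{\beta\in\mathrm{PF}:\mathrm{st}(\beta)=\mathrm{st}(\alpha),|\beta|=|\alpha|\}$. $\mathcal{A}^{\mathrm{PF}}_{\mathrm{st}}$ is the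 algebra with basis these classes and product $[\alpha]^{\mathrm{PF}}_{\mathrm{st}}[\beta]^{\mathrm{PF}}_{\mathrm{st}}=\sum_{\gamma\in\overrightarrow{\mathrm{Sh}}(\alpha,\beta)}[\gamma]^{\mathrm{PF}}_{\mathrm{st}}$. $\mathrm{PQSym}$ is the algebra with basis $\{F_\alpha\}_{\alpha\in\mathrm{PF}}$ and product $F_\alpha F_\beta=\sum_{\gamma\in\overrightarrow{\mathrm{Sh}}(\alpha,\beta)}F_\gamma$. *)

theory Defs
  imports
    "HOL-Algebra.QuotRing"
    "HOL-Algebra.Module"
    "HOL-Algebra.Algebraic_Closure_Type"
    "HOL-Library.Poly_Mapping"
    "HOL-Library.Multiset"
begin

section \<open>Associative algebras, quotients and isomorphisms\<close>

text \<open>The locale \<^locale>\<open>algebra\<close> of HOL-Algebra requires the multiplication to be commutative.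
  The algebras considered here are associative and unital, but not commutative.\<close>

locale assoc_algebra = module R M + M?: ring M for R (structure) and M (structure) +
  assumes smult_mult_left:
      "\<lbrakk>a \<in> carrier R; x \<in> carrier M; y \<in> carrier M\<rbrakk> \<Longrightarrow>
        (a \<odot>\<^bsub>M\<^esub> x) \<otimes>\<^bsub>M\<^esub> y = a \<odot>\<^bsub>M\<^esub> (x \<otimes>\<^bsub>M\<^esub> y)"
    and smult_mult_right:
      "\<lbrakk>a \<in> carrier R; x \<in> carrier M; y \<in> carrier M\<rbrakk> \<Longrightarrow>
        x \<otimes>\<^bsub>M\<^esub> (a \<odot>\<^bsub>M\<^esub> y) = a \<odot>\<^bsub>M\<^esub> (x \<otimes>\<^bsub>M\<^esub> y)"

definition algebra_isomorphic ::
  "('r, 'q) ring_scheme \<Rightarrow> ('r, 'a) module \<Rightarrow> ('r, 'b) module \<Rightarrow> bool"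
  where "algebra_isomorphic R A B \<longleftrightarrow>
    assoc_algebra R A \<and> assoc_algebra R B \<and>
    (\<exists>h \<in> ring_iso A B. \<forall>c \<in> carrier R. \<forall>x \<in> carrier A. h (c \<odot>\<^bsub>A\<^esub> x) = c \<odot>\<^bsub>B\<^esub> h x)"

text \<open>The quotient ring \<open>M Quot I\<close> with the scalar multiplication \<open>c (I + x) = I + c x\<close> (written as a
  union over the representatives, like \<^const>\<open>rcoset_mult\<close>). A two-sided ring ideal of a unital
  algebra is automatically closed under scalars, since \<open>c x = (c 1) x\<close>.\<close>

definition quot_algebra :: "('r, 'a) module \<Rightarrow> 'a set \<Rightarrow> ('r, 'a set) module"
  where "quot_algebra M I =
    \<lparr>carrier = carrier (M Quot I), monoid.mult = monoid.mult (M Quot I), one = one (M Quot I),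
     zero = zero (M Quot I), add = add (M Quot I),
     module.smult = (\<lambda>c C. \<Union>x\<in>C. I +>\<^bsub>M\<^esub> (c \<odot>\<^bsub>M\<^esub> x))\<rparr>"

section \<open>Rational algebras given by a basis and structure constants\<close>

abbreviation Rats_ring :: "rat ring"
  where "Rats_ring \<equiv> ring_of_type_algebra"

definition basis_elt :: "'a \<Rightarrow> ('a \<Rightarrow>\<^sub>0 rat)"
  where "basis_elt a = Poly_Mapping.single a 1"

definition scale :: "rat \<Rightarrow> ('a \<Rightarrow>\<^sub>0 rat) \<Rightarrow> ('a \<Rightarrow>\<^sub>0 rat)"
  where "scale c p = Poly_Mapping.map (\<lambda>x. c * x) p"

text \<open>The free \<open>\<rat>\<close>-vector space on \<open>S\<close>, with the bilinear extension of \<open>m\<close> as multiplication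
  and the basis element \<open>e\<close> as unit.\<close>

definition basis_algebra ::
  "'a set \<Rightarrow> ('a \<Rightarrow> 'a \<Rightarrow> ('a \<Rightarrow>\<^sub>0 rat)) \<Rightarrow> 'a \<Rightarrow> (rat, 'a \<Rightarrow>\<^sub>0 rat) module"
  where "basis_algebra S m e =
    \<lparr>carrier = {p. Poly_Mapping.keys p \<subseteq> S},
     monoid.mult = (\<lambda>p q. \<Sum>a\<in>Poly_Mapping.keys p. \<Sum>b\<in>Poly_Mapping.keys q.
               scale (Poly_Mapping.lookup p a * Poly_Mapping.lookup q b) (m a b)),
     one = basis_elt e,
     zero = 0,
     add = (+),
     module.smult = scale\<rparr>"

lemma basis_algebra_mult_basis:
  "basis_elt a \<otimes>\<^bsub>basis_algebra S m e\<^esub> basis_elt b = m a b"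
proof -
  have "scale 1 p = p" for p :: "'a \<Rightarrow>\<^sub>0 rat"
    by (rule poly_mapping_eqI) (simp add: scale_def Poly_Mapping.map.rep_eq when_def)
  then show ?thesis
    by (simp add: basis_algebra_def basis_elt_def)
qed

section \<open>Parking functions and the shifted shuffle algebra\<close>

text \<open>Lists are indexed from \<open>0\<close>, so the condition \<open>\<alpha>'\<^sub>i \<le> i\<close> becomes \<open>sort \<alpha> ! i \<le> i + 1\<close>.\<close>

definition PF :: "nat list set"
  where "PF = {\<alpha>. (\<forall>a \<in> set \<alpha>. 0 < a) \<and> (\<forall>i < length \<alpha>. sort \<alpha> ! i \<le> i + 1)}"

text \<open>All letters of the shifted word exceed those of the parking function \<open>\<alpha>\<close>, so distinct
  interleavings are distinct words.\<close>

definition shifted_shuffle :: "nat list \<Rightarrow> nat list \<Rightarrow> nat list set"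
  where "shifted_shuffle \<alpha> \<beta> = shuffles \<alpha> (map (\<lambda>b. b + length \<alpha>) \<beta>)"

text \<open>A statistic takes values in an arbitrary type; its values outside \<^const>\<open>PF\<close> play no role.\<close>

definition weakly_shuffle_compatible_PF :: "(nat list \<Rightarrow> 's) \<Rightarrow> bool"
  where "weakly_shuffle_compatible_PF st \<longleftrightarrow>
    (\<forall>\<alpha>\<in>PF. \<forall>\<beta>\<in>PF. \<forall>\<alpha>'\<in>PF. \<forall>\<beta>'\<in>PF.
      length \<alpha> = length \<alpha>' \<and> length \<beta> = length \<beta>' \<and> st \<alpha> = st \<alpha>' \<and> st \<beta> = st \<beta>' \<longrightarrow>
      image_mset st (mset_set (shifted_shuffle \<alpha> \<beta>)) =
      image_mset st (mset_set (shifted_shuffle \<alpha>' \<beta>')))"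

definition PF_class :: "(nat list \<Rightarrow> 's) \<Rightarrow> nat list \<Rightarrow> nat list set"
  where "PF_class st \<alpha> = {\<beta> \<in> PF. st \<beta> = st \<alpha> \<and> length \<beta> = length \<alpha>}"

definition PQSym :: "(rat, nat list \<Rightarrow>\<^sub>0 rat) module"
  where "PQSym = basis_algebra PF (\<lambda>\<alpha> \<beta>. \<Sum>\<gamma>\<in>shifted_shuffle \<alpha> \<beta>. basis_elt \<gamma>) []"

text \<open>The product of two classes is defined through chosen representatives; the lemma
  \<open>shuffle_algebra_PF_mult_class\<close> below shows that it does not depend on them when \<open>st\<close> is weakly
  shuffle-compatible.\<close>

definition shuffle_algebra_PF :: "(nat list \<Rightarrow> 's) \<Rightarrow> (rat, nat list set \<Rightarrow>\<^sub>0 rat) module"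
  where "shuffle_algebra_PF st =
    basis_algebra (PF_class st ` PF)
      (\<lambda>C D. \<Sum>\<gamma>\<in>shifted_shuffle (SOME \<alpha>. \<alpha> \<in> C) (SOME \<beta>. \<beta> \<in> D). basis_elt (PF_class st \<gamma>))
      (PF_class st [])"

lemma PQSym_mult_basis:
  "basis_elt \<alpha> \<otimes>\<^bsub>PQSym\<^esub> basis_elt \<beta> = (\<Sum>\<gamma>\<in>shifted_shuffle \<alpha> \<beta>. basis_elt \<gamma>)"
  unfolding PQSym_def by (rule basis_algebra_mult_basis)

lemma shuffle_algebra_PF_mult_class:
  assumes "weakly_shuffle_compatible_PF st" and "\<alpha> \<in> PF" and "\<beta> \<in> PF"
  shows "basis_elt (PF_class st \<alpha>) \<otimes>\<^bsub>shuffle_algebra_PF st\<^esub> basis_elt (PF_class st \<beta>) =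
    (\<Sum>\<gamma>\<in>shifted_shuffle \<alpha> \<beta>. basis_elt (PF_class st \<gamma>))"
proof -
  define \<alpha>' where "\<alpha>' = (SOME a. a \<in> PF_class st \<alpha>)"
  define \<beta>' where "\<beta>' = (SOME b. b \<in> PF_class st \<beta>)"
  define B where "B s = basis_elt {\<delta> \<in> PF. st \<delta> = s \<and> length \<delta> = length \<alpha> + length \<beta>}" for s
  have "\<alpha> \<in> PF_class st \<alpha>" "\<beta> \<in> PF_class st \<beta>"
    using assms(2,3) by (auto simp: PF_class_def)
  then have "\<alpha>' \<in> PF_class st \<alpha>" "\<beta>' \<in> PF_class st \<beta>"
    unfolding \<alpha>'_def \<beta>'_def by (auto intro: someI)
  then have rep: "\<alpha>' \<in> PF" "\<beta>' \<in> PF" "length \<alpha> = length \<alpha>'" "length \<beta> = length \<beta>'"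
      "st \<alpha> = st \<alpha>'" "st \<beta> = st \<beta>'"
    by (auto simp: PF_class_def)
  have sum: "(\<Sum>\<gamma>\<in>shifted_shuffle a b. basis_elt (PF_class st \<gamma>)) =
      sum_mset (image_mset B (image_mset st (mset_set (shifted_shuffle a b))))"
    if "length a = length \<alpha>" "length b = length \<beta>" for a b
  proof -
    have "length \<gamma> = length \<alpha> + length \<beta>" if "\<gamma> \<in> shifted_shuffle a b" for \<gamma>
      using that \<open>length a = _\<close> \<open>length b = _\<close> by (auto simp: shifted_shuffle_def length_shuffles)
    then have "(\<Sum>\<gamma>\<in>shifted_shuffle a b. basis_elt (PF_class st \<gamma>)) =
        (\<Sum>\<gamma>\<in>shifted_shuffle a b. B (st \<gamma>))"
      by (intro sum.cong) (simp_all add: B_def PF_class_def)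
    then show ?thesis
      by (simp add: sum_unfold_sum_mset multiset.map_comp comp_def)
  qed
  have "image_mset st (mset_set (shifted_shuffle \<alpha> \<beta>)) =
      image_mset st (mset_set (shifted_shuffle \<alpha>' \<beta>'))"
    using assms rep unfolding weakly_shuffle_compatible_PF_def by blast
  then have "(\<Sum>\<gamma>\<in>shifted_shuffle \<alpha>' \<beta>'. basis_elt (PF_class st \<gamma>)) =
      (\<Sum>\<gamma>\<in>shifted_shuffle \<alpha> \<beta>. basis_elt (PF_class st \<gamma>))"
    using sum[of \<alpha> \<beta>] sum[of \<alpha>' \<beta>'] rep by simp
  then show ?thesis
    unfolding shuffle_algebra_PF_def basis_algebra_mult_basis \<alpha>'_def \<beta>'_def .
qed

end

theory Submission
  imports Defs
begin

text \<open>By weak shuffle-compatibility the linear map sending \<open>F\<^sub>\<alpha>\<close> to the class of \<open>\<alpha>\<close> is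
  multiplicative, and it is surjective. The shifted shuffle algebra therefore inherits the algebra
  axioms from \<open>PQSym\<close>, and the ideal sought is the kernel of this map.\<close>

section \<open>Linear extension from a basis\<close>

lemma lookup_scale [simp]: "Poly_Mapping.lookup (scale c p) k = c * Poly_Mapping.lookup p k"
  by (simp add: scale_def Poly_Mapping.map.rep_eq when_def)

lemma keys_scale: "Poly_Mapping.keys (scale c p) \<subseteq> Poly_Mapping.keys p"
  by (auto simp: in_keys_iff)

lemma scale_zero_left [simp]: "scale 0 p = 0"
  and scale_zero_right [simp]: "scale c 0 = 0"
  and scale_one [simp]: "scale 1 p = p"
  and scale_scale [simp]: "scale c (scale d p) = scale (c * d) p"
  and scale_add_left: "scale (c + d) p = scale c p + scale d p"
  and scale_add_right: "scale c (p + q) = scale c p + scale c q"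
  by (rule poly_mapping_eqI; simp add: lookup_add algebra_simps)+

lemma scale_sum: "scale c (\<Sum>i\<in>A. f i) = (\<Sum>i\<in>A. scale c (f i))"
  by (rule poly_mapping_eqI) (simp add: lookup_sum sum_distrib_left)

text \<open>The product of \<open>basis_algebra\<close> is two nested copies of this map, one for
  each factor, so bilinearity reduces to linearity in \<open>p\<close> and linearity in
  \<open>g\<close>.\<close>

definition lin_ext :: "('a \<Rightarrow> ('b \<Rightarrow>\<^sub>0 rat)) \<Rightarrow> ('a \<Rightarrow>\<^sub>0 rat) \<Rightarrow> ('b \<Rightarrow>\<^sub>0 rat)"
  where "lin_ext g p = (\<Sum>a\<in>Poly_Mapping.keys p. scale (Poly_Mapping.lookup p a) (g a))"

text \<open>The index set in the definition depends on \<open>p\<close>. Enlarging it adds only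
  terms with coefficient 0, so several vectors can be summed over one common index set.\<close>

lemma lin_ext_superset:
  assumes "finite A" "Poly_Mapping.keys p \<subseteq> A"
  shows "lin_ext g p = (\<Sum>a\<in>A. scale (Poly_Mapping.lookup p a) (g a))"
  unfolding lin_ext_def by (rule sum.mono_neutral_left) (use assms in \<open>auto simp: in_keys_iff\<close>)

lemma lin_ext_zero [simp]: "lin_ext g 0 = 0"
  by (simp add: lin_ext_def)

lemma lin_ext_basis [simp]: "lin_ext g (basis_elt a) = g a"
  by (simp add: lin_ext_def basis_elt_def)

lemma lin_ext_add: "lin_ext g (p + q) = lin_ext g p + lin_ext g q"
proof -
  let ?A = "Poly_Mapping.keys p \<union> Poly_Mapping.keys q"
  have "lin_ext g (p + q) = (\<Sum>a\<in>?A. scale (Poly_Mapping.lookup (p + q) a) (g a))"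
    by (rule lin_ext_superset) (use keys_add[of p q] in auto)
  also have "\<dots> = lin_ext g p + lin_ext g q"
    by (simp add: lookup_add scale_add_left sum.distrib lin_ext_superset[where A = ?A])
  finally show ?thesis .
qed

lemma lin_ext_scale: "lin_ext g (scale c p) = scale c (lin_ext g p)"
  by (subst lin_ext_superset[where A = "Poly_Mapping.keys p"])
    (simp_all add: keys_scale lin_ext_def scale_sum)

lemma lin_ext_sum: "lin_ext g (\<Sum>i\<in>A. f i) = (\<Sum>i\<in>A. lin_ext g (f i))"
  by (induction A rule: infinite_finite_induct) (simp_all add: lin_ext_add)

text \<open>This and the next two lemmas give linearity in the function. In a nested product the
  right factor occurs inside that function, so linearity in the right factor rests on them.\<close>

lemma lin_ext_fun_zero [simp]: "lin_ext (\<lambda>a. 0) p = 0"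
  by (simp add: lin_ext_def)

lemma lin_ext_fun_add: "lin_ext (\<lambda>a. g a + h a) p = lin_ext g p + lin_ext h p"
  by (simp add: lin_ext_def scale_add_right sum.distrib)

lemma lin_ext_fun_scale: "lin_ext (\<lambda>a. scale c (g a)) p = scale c (lin_ext g p)"
  by (simp add: lin_ext_def scale_sum mult.commute)

lemma lin_ext_eq_self [simp]: "lin_ext basis_elt p = p"
proof (rule poly_mapping_eqI)
  fix k
  have "Poly_Mapping.lookup (lin_ext basis_elt p) k =
      (\<Sum>a\<in>Poly_Mapping.keys p. if a = k then Poly_Mapping.lookup p a else 0)"
    unfolding lin_ext_def lookup_sum
    by (rule sum.cong) (auto simp: basis_elt_def lookup_single when_def)
  then show "Poly_Mapping.lookup (lin_ext basis_elt p) k = Poly_Mapping.lookup p k"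
    by (simp add: in_keys_iff)
qed

text \<open>Each vector is a finite linear combination of basis elements, so a property stable under
  linear combinations need only be checked on the basis.\<close>

lemma basis_induct [consumes 1, case_names zero basis add scale]:
  assumes "Poly_Mapping.keys p \<subseteq> S"
    and zero: "P 0"
    and basis: "\<And>a. a \<in> S \<Longrightarrow> P (basis_elt a)"
    and add: "\<And>p q. P p \<Longrightarrow> P q \<Longrightarrow> P (p + q)"
    and scale: "\<And>c p. P p \<Longrightarrow> P (scale c p)"
  shows "P p"
proof -
  \<comment> \<open>Index set and coefficients are decoupled from \<open>p\<close>, so that the
    induction can run over finite sets alone.\<close>
  have "P (\<Sum>a\<in>A. scale (c a) (basis_elt a))" if "finite A" "A \<subseteq> S" for A c
    using that by (induction A) (auto intro: zero basis add scale)
  from this[of "Poly_Mapping.keys p"] assms(1) have "P (lin_ext basis_elt p)"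
    by (simp add: lin_ext_def)
  then show ?thesis by simp
qed

section \<open>Supports of linear combinations\<close>

lemma keys_basis_elt [simp]: "Poly_Mapping.keys (basis_elt a) = {a}"
  by (simp add: basis_elt_def)

lemma keys_add_subset:
  "Poly_Mapping.keys p \<subseteq> S \<Longrightarrow> Poly_Mapping.keys q \<subseteq> S \<Longrightarrow> Poly_Mapping.keys (p + q) \<subseteq> S"
  using keys_add[of p q] by blast

lemma keys_scale_subset:
  "Poly_Mapping.keys p \<subseteq> S \<Longrightarrow> Poly_Mapping.keys (scale c p) \<subseteq> S"
  using keys_scale[of c p] by blast

lemma keys_sum_subset:
  "(\<And>i. i \<in> A \<Longrightarrow> Poly_Mapping.keys (f i) \<subseteq> S) \<Longrightarrow> Poly_Mapping.keys (\<Sum>i\<in>A. f i) \<subseteq> S"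
  by (induction A rule: infinite_finite_induct) (simp_all add: keys_add_subset)

lemma keys_lin_ext:
  assumes "Poly_Mapping.keys p \<subseteq> S" "\<And>a. a \<in> S \<Longrightarrow> Poly_Mapping.keys (g a) \<subseteq> T"
  shows "Poly_Mapping.keys (lin_ext g p) \<subseteq> T"
  unfolding lin_ext_def using assms by (intro keys_sum_subset keys_scale_subset) blast

section \<open>Algebras given by structure constants\<close>

lemma basis_algebra_simps:
  "carrier (basis_algebra S m e) = {p. Poly_Mapping.keys p \<subseteq> S}"
  "p \<otimes>\<^bsub>basis_algebra S m e\<^esub> q = lin_ext (\<lambda>a. lin_ext (m a) q) p"
  "\<one>\<^bsub>basis_algebra S m e\<^esub> = basis_elt e"
  "\<zero>\<^bsub>basis_algebra S m e\<^esub> = 0"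
  "p \<oplus>\<^bsub>basis_algebra S m e\<^esub> q = p + q"
  "c \<odot>\<^bsub>basis_algebra S m e\<^esub> p = scale c p"
  by (simp_all add: basis_algebra_def lin_ext_def scale_sum)

lemma Rats_ring_simps [simp]:
  "carrier Rats_ring = UNIV"
  "c \<otimes>\<^bsub>Rats_ring\<^esub> d = c * d"
  "\<one>\<^bsub>Rats_ring\<^esub> = (1 :: rat)"
  "\<zero>\<^bsub>Rats_ring\<^esub> = (0 :: rat)"
  "c \<oplus>\<^bsub>Rats_ring\<^esub> d = c + d"
  by (simp_all add: ring_of_type_algebra_def)

text \<open>By bilinearity the axioms need only hold on the basis. In \<open>assoc\<close> the two
  sides are the products (ab)c and a(bc) of basis elements, written with \<open>lin_ext\<close>
  because \<open>m a b\<close> and \<open>m b c\<close> are already linear combinations.\<close>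

lemma assoc_algebra_basis_algebra:
  assumes closed: "\<And>a b. a \<in> S \<Longrightarrow> b \<in> S \<Longrightarrow> Poly_Mapping.keys (m a b) \<subseteq> S"
    and e: "e \<in> S"
    and unit_left: "\<And>a. a \<in> S \<Longrightarrow> m e a = basis_elt a"
    and unit_right: "\<And>a. a \<in> S \<Longrightarrow> m a e = basis_elt a"
    and assoc: "\<And>a b c. a \<in> S \<Longrightarrow> b \<in> S \<Longrightarrow> c \<in> S \<Longrightarrow>
      lin_ext (\<lambda>x. m x c) (m a b) = lin_ext (m a) (m b c)"
  shows "assoc_algebra Rats_ring (basis_algebra S m e)"
proof -
  let ?B = "basis_algebra S m e"
  define mul where "mul p q = lin_ext (\<lambda>a. lin_ext (m a) q) p" for p q
  have mul_simps:
    "mul 0 q = 0" "mul p 0 = 0"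
    "mul (p + p') q = mul p q + mul p' q" "mul p (q + q') = mul p q + mul p q'"
    "mul (scale k p) q = scale k (mul p q)" "mul p (scale k q) = scale k (mul p q)"
    "mul (basis_elt a) (basis_elt b) = m a b"
    for p p' q q' k a b
    by (simp_all add: mul_def lin_ext_add lin_ext_scale lin_ext_fun_add lin_ext_fun_scale)
  note B_simps = basis_algebra_simps[of S m e, folded mul_def]
  have mul_closed: "Poly_Mapping.keys (mul p q) \<subseteq> S"
    if "Poly_Mapping.keys p \<subseteq> S" "Poly_Mapping.keys q \<subseteq> S" for p q
    unfolding mul_def by (intro keys_lin_ext[where S = S] closed that)
  have one_l: "mul (basis_elt e) p = p" and one_r: "mul p (basis_elt e) = p"
    if "Poly_Mapping.keys p \<subseteq> S" for p
    using that by (induction rule: basis_induct) (simp_all add: mul_simps e unit_left unit_right)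
  have mul_basis_right: "mul p (basis_elt c) = lin_ext (\<lambda>x. m x c) p"
    and mul_basis_left: "mul (basis_elt a) p = lin_ext (m a) p" for p a c
    by (simp_all add: mul_def)
  \<comment> \<open>Associativity spreads from the basis to one factor at a time: first the left
    factor, then the middle one, then the right one.\<close>
  have assoc_basis: "mul (mul p (basis_elt b)) (basis_elt c) = mul p (mul (basis_elt b) (basis_elt c))"
    if "Poly_Mapping.keys p \<subseteq> S" "b \<in> S" "c \<in> S" for p b c
    using that(1)
    by (induction rule: basis_induct)
      (use that in \<open>simp_all add: mul_simps mul_basis_right[of "m _ _"] mul_basis_left[of _ "m _ _"] assoc\<close>)
  have assoc_basis': "mul (mul p q) (basis_elt c) = mul p (mul q (basis_elt c))"
    if "Poly_Mapping.keys p \<subseteq> S" "Poly_Mapping.keys q \<subseteq> S" "c \<in> S" for p q c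
    using that(2)
    by (induction rule: basis_induct) (use that assoc_basis in \<open>simp_all add: mul_simps\<close>)
  have mul_assoc: "mul (mul p q) r = mul p (mul q r)"
    if "Poly_Mapping.keys p \<subseteq> S" "Poly_Mapping.keys q \<subseteq> S" "Poly_Mapping.keys r \<subseteq> S" for p q r
    using that(3)
    by (induction rule: basis_induct) (use that assoc_basis' in \<open>simp_all add: mul_simps\<close>)
  have group: "abelian_group ?B"
  proof (rule abelian_groupI)
    fix p assume "p \<in> carrier ?B"
    then show "\<exists>y\<in>carrier ?B. y \<oplus>\<^bsub>?B\<^esub> p = \<zero>\<^bsub>?B\<^esub>"
      by (intro bexI[of _ "- p"]) (simp_all add: B_simps)
  qed (simp_all add: B_simps keys_add_subset add.assoc add.commute)
  have "monoid ?B"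
    by unfold_locales (simp_all add: B_simps mul_closed mul_assoc one_l one_r e)
  with group have "ring ?B"
    by (intro ringI) (simp_all add: B_simps mul_simps)
  moreover have "module Rats_ring ?B"
    by (intro moduleI cring_from_type_algebra group)
      (simp_all add: B_simps keys_scale_subset scale_add_left scale_add_right)
  ultimately show ?thesis
    by (intro assoc_algebra.intro assoc_algebra_axioms.intro) (simp_all add: B_simps mul_simps)
qed

text \<open>Both sides of the multiplicativity law are bilinear, so it suffices to compare them on
  pairs of basis elements.\<close>

lemma lin_ext_ring_hom:
  assumes keys: "\<And>a. a \<in> S \<Longrightarrow> Poly_Mapping.keys (g a) \<subseteq> T"
    and mult: "\<And>a b. a \<in> S \<Longrightarrow> b \<in> S \<Longrightarrow> lin_ext g (m a b) = g a \<otimes>\<^bsub>basis_algebra T m' e'\<^esub> g b"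
    and one: "g e = basis_elt e'"
  shows "lin_ext g \<in> ring_hom (basis_algebra S m e) (basis_algebra T m' e')"
proof (rule ring_hom_memI)
  fix p q
  assume "p \<in> carrier (basis_algebra S m e)" "q \<in> carrier (basis_algebra S m e)"
  then have p: "Poly_Mapping.keys p \<subseteq> S" and q: "Poly_Mapping.keys q \<subseteq> S"
    by (simp_all add: basis_algebra_simps)
  \<comment> \<open>The left factor is still a basis element here, and the induction runs over the
    right factor. The right-hand side is the product of \<open>g a\<close> and
    \<open>lin_ext g q\<close>, unfolded.\<close>
  have basis: "lin_ext g (lin_ext (m a) q) = lin_ext (\<lambda>a. lin_ext (m' a) (lin_ext g q)) (g a)"
    if "a \<in> S" for a
    using q
    by (induction rule: basis_induct)
      (use that mult in \<open>simp_all add: basis_algebra_simps lin_ext_add lin_ext_scale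
        lin_ext_fun_add lin_ext_fun_scale\<close>)
  show "lin_ext g (p \<otimes>\<^bsub>basis_algebra S m e\<^esub> q) =
      lin_ext g p \<otimes>\<^bsub>basis_algebra T m' e'\<^esub> lin_ext g q"
    unfolding basis_algebra_simps using p
    by (induction rule: basis_induct) (simp_all add: lin_ext_add lin_ext_scale basis)
qed (simp_all add: basis_algebra_simps lin_ext_add one keys keys_lin_ext[where S = S])

text \<open>The image is a subspace, and it contains every basis element of the target.\<close>

lemma lin_ext_image:
  "lin_ext (\<lambda>a. basis_elt (f a)) ` {p. Poly_Mapping.keys p \<subseteq> S} = {p. Poly_Mapping.keys p \<subseteq> f ` S}"
    (is "?\<phi> ` ?C = ?D")
proof
  show "?\<phi> ` ?C \<subseteq> ?D"
    by (simp add: image_subset_iff keys_lin_ext[where S = S])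
  have "q \<in> ?\<phi> ` ?C" if "Poly_Mapping.keys q \<subseteq> f ` S" for q
    using that
  proof (induction rule: basis_induct)
    case zero
    show ?case by (rule image_eqI[of _ _ 0]) simp_all
  next
    case (basis b)
    then obtain a where "a \<in> S" "b = f a" by blast
    then show ?case by (intro image_eqI[of _ _ "basis_elt a"]) simp_all
  next
    case (add p q)
    then obtain p' q' where "p = ?\<phi> p'" "q = ?\<phi> q'" "p' \<in> ?C" "q' \<in> ?C" by blast
    then show ?case
      by (intro image_eqI[of _ _ "p' + q'"]) (simp_all add: lin_ext_add keys_add_subset)
  next
    case (scale c p)
    then obtain p' where "p = ?\<phi> p'" "p' \<in> ?C" by blast
    then show ?case
      by (intro image_eqI[of _ _ "scale c p'"]) (simp_all add: lin_ext_scale keys_scale_subset)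
  qed
  then show "?D \<subseteq> ?\<phi> ` ?C" by blast
qed

section \<open>Homomorphic images and quotients\<close>

text \<open>The axioms are identities, so they pass to \<open>N\<close> through preimages.
  \<open>N\<close> is not assumed to be a ring: thus a structure whose product is defined through
  chosen representatives need not be examined directly. Preservation of zero is a separate
  hypothesis since \<open>ring_hom\<close> speaks only of sums, products and one.\<close>

lemma assoc_algebra_hom_image:
  fixes R (structure) and M (structure) and N (structure)
  assumes "assoc_algebra R M"
    and hom: "h \<in> ring_hom M N"
    and smult: "\<And>c x. c \<in> carrier R \<Longrightarrow> x \<in> carrier M \<Longrightarrow> h (c \<odot>\<^bsub>M\<^esub> x) = c \<odot>\<^bsub>N\<^esub> h x"
    and zero: "h \<zero>\<^bsub>M\<^esub> = \<zero>\<^bsub>N\<^esub>"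
    and surj: "h ` carrier M = carrier N"
  shows "assoc_algebra R N"
proof -
  interpret A: assoc_algebra R M by fact
  \<comment> \<open>The library makes the image a ring with carrier and zero replaced by images. By
    \<open>surj\<close> and \<open>zero\<close> this replacement changes nothing.\<close>
  have "N \<lparr>carrier := h ` carrier M, zero := h \<zero>\<^bsub>M\<^esub>\<rparr> = N"
    unfolding surj zero by simp
  then have ring: "ring N"
    using A.M.ring_hom_imp_img_ring[OF hom] by simp
  note h = ring_hom_memE[OF hom]
  have pre: "\<exists>x. x \<in> carrier M \<and> y = h x" if "y \<in> carrier N" for y
    using that surj by blast
  have "module R N"
  proof (rule moduleI)
    fix c y assume c: "c \<in> carrier R" and "y \<in> carrier N"
    then obtain x where x: "x \<in> carrier M" "y = h x" using pre by blast
    show "c \<odot>\<^bsub>N\<^esub> y \<in> carrier N"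
      using c x h(1)[of "c \<odot>\<^bsub>M\<^esub> x"] by (simp add: smult)
  next
    fix c d y assume c: "c \<in> carrier R" "d \<in> carrier R" and "y \<in> carrier N"
    then obtain x where x: "x \<in> carrier M" "y = h x" using pre by blast
    show "(c \<oplus>\<^bsub>R\<^esub> d) \<odot>\<^bsub>N\<^esub> y = c \<odot>\<^bsub>N\<^esub> y \<oplus>\<^bsub>N\<^esub> d \<odot>\<^bsub>N\<^esub> y"
      using c x by (simp add: smult[symmetric] h(3)[symmetric] A.smult_l_distr)
    show "(c \<otimes>\<^bsub>R\<^esub> d) \<odot>\<^bsub>N\<^esub> y = c \<odot>\<^bsub>N\<^esub> (d \<odot>\<^bsub>N\<^esub> y)"
      using c x by (simp add: smult[symmetric] A.smult_assoc1)
  next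
    fix c y z assume c: "c \<in> carrier R" and "y \<in> carrier N" "z \<in> carrier N"
    then obtain x w where x: "x \<in> carrier M" "y = h x" "w \<in> carrier M" "z = h w" using pre by blast
    show "c \<odot>\<^bsub>N\<^esub> (y \<oplus>\<^bsub>N\<^esub> z) = c \<odot>\<^bsub>N\<^esub> y \<oplus>\<^bsub>N\<^esub> c \<odot>\<^bsub>N\<^esub> z"
      using c x by (simp add: smult[symmetric] h(3)[symmetric] A.smult_r_distr)
  next
    fix y assume "y \<in> carrier N"
    then obtain x where x: "x \<in> carrier M" "y = h x" using pre by blast
    show "\<one>\<^bsub>R\<^esub> \<odot>\<^bsub>N\<^esub> y = y"
      using x by (simp add: smult[symmetric])
  qed (rule A.R.cring_axioms, rule ring.is_abelian_group[OF ring])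
  moreover have "assoc_algebra_axioms R N"
  proof
    fix c y z assume c: "c \<in> carrier R" and "y \<in> carrier N" "z \<in> carrier N"
    then obtain x w where x: "x \<in> carrier M" "y = h x" "w \<in> carrier M" "z = h w" using pre by blast
    show "(c \<odot>\<^bsub>N\<^esub> y) \<otimes>\<^bsub>N\<^esub> z = c \<odot>\<^bsub>N\<^esub> (y \<otimes>\<^bsub>N\<^esub> z)"
      using c x by (simp add: smult[symmetric] h(2)[symmetric] A.smult_mult_left)
    show "y \<otimes>\<^bsub>N\<^esub> (c \<odot>\<^bsub>N\<^esub> z) = c \<odot>\<^bsub>N\<^esub> (y \<otimes>\<^bsub>N\<^esub> z)"
      using c x by (simp add: smult[symmetric] h(2)[symmetric] A.smult_mult_right)
  qed
  ultimately show ?thesis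
    using ring by (intro assoc_algebra.intro)
qed

text \<open>The union over representatives collapses to one coset: two representatives differ by
  some i in \<open>I\<close>, and c i = (c 1) i lies in \<open>I\<close> again.\<close>

lemma quot_algebra_smult:
  assumes "assoc_algebra R M" "ideal I M" "c \<in> carrier R" "x \<in> carrier M"
  shows "c \<odot>\<^bsub>quot_algebra M I\<^esub> (I +>\<^bsub>M\<^esub> x) = I +>\<^bsub>M\<^esub> (c \<odot>\<^bsub>M\<^esub> x)"
proof -
  interpret A: assoc_algebra R M by fact
  interpret I: ideal I M by fact
  have "I +>\<^bsub>M\<^esub> (c \<odot>\<^bsub>M\<^esub> y) = I +>\<^bsub>M\<^esub> (c \<odot>\<^bsub>M\<^esub> x)" if "y \<in> I +>\<^bsub>M\<^esub> x" for y
  proof -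
    from that obtain i where i: "i \<in> I" "y = i \<oplus>\<^bsub>M\<^esub> x"
      by (auto simp: a_r_coset_def')
    have iM: "i \<in> carrier M"
      using i by (simp add: I.Icarr)
    have "c \<odot>\<^bsub>M\<^esub> i = (c \<odot>\<^bsub>M\<^esub> \<one>\<^bsub>M\<^esub>) \<otimes>\<^bsub>M\<^esub> i"
      using assms(3) iM by (simp add: A.smult_mult_left)
    also have "\<dots> \<in> I"
      using assms(3) i by (simp add: I.I_l_closed)
    finally have "c \<odot>\<^bsub>M\<^esub> y \<in> I +>\<^bsub>M\<^esub> (c \<odot>\<^bsub>M\<^esub> x)"
      using assms(3,4) iM i by (auto simp: a_r_coset_def' A.smult_r_distr)
    then show ?thesis
      using I.a_repr_independence' A.smult_closed[OF assms(3,4)] by blast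
  qed
  moreover have "x \<in> I +>\<^bsub>M\<^esub> x"
    using assms(4) by (rule I.a_rcos_self)
  ultimately have "(\<Union>y\<in>I +>\<^bsub>M\<^esub> x. I +>\<^bsub>M\<^esub> (c \<odot>\<^bsub>M\<^esub> y)) = I +>\<^bsub>M\<^esub> (c \<odot>\<^bsub>M\<^esub> x)"
    by blast
  then show ?thesis
    by (simp add: quot_algebra_def)
qed

text \<open>The quotient is the image of \<open>M\<close> under the canonical projection, so it
  inherits the axioms.\<close>

lemma assoc_algebra_quot_algebra:
  assumes "assoc_algebra R M" "ideal I M"
  shows "assoc_algebra R (quot_algebra M I)"
proof (rule assoc_algebra_hom_image[OF assms(1), where h = "(+>\<^bsub>M\<^esub>) I"])
  interpret I: ideal I M by fact
  show "(+>\<^bsub>M\<^esub>) I \<in> ring_hom M (quot_algebra M I)"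
    using I.rcos_ring_hom by (simp add: ring_hom_def quot_algebra_def)
  show "I +>\<^bsub>M\<^esub> (c \<odot>\<^bsub>M\<^esub> x) = c \<odot>\<^bsub>quot_algebra M I\<^esub> (I +>\<^bsub>M\<^esub> x)"
    if "c \<in> carrier R" "x \<in> carrier M" for c x
    using quot_algebra_smult[OF assms that] by simp
  show "I +>\<^bsub>M\<^esub> \<zero>\<^bsub>M\<^esub> = \<zero>\<^bsub>quot_algebra M I\<^esub>"
    by (simp add: quot_algebra_def FactRing_def I.a_rcos_const)
  show "(+>\<^bsub>M\<^esub>) I ` carrier M = carrier (quot_algebra M I)"
    by (auto simp: quot_algebra_def FactRing_def A_RCOSETS_def')
qed

lemma first_isomorphism:
  assumes M: "assoc_algebra R M" and N: "assoc_algebra R N"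
    and hom: "h \<in> ring_hom M N"
    and smult: "\<And>c x. c \<in> carrier R \<Longrightarrow> x \<in> carrier M \<Longrightarrow> h (c \<odot>\<^bsub>M\<^esub> x) = c \<odot>\<^bsub>N\<^esub> h x"
    and surj: "h ` carrier M = carrier N"
  shows "ideal (a_kernel M N h) M \<and> algebra_isomorphic R N (quot_algebra M (a_kernel M N h))"
proof -
  interpret M: assoc_algebra R M by fact
  interpret N: assoc_algebra R N by fact
  interpret h: ring_hom_ring M N h
    using hom by (rule ring_hom_ringI2[OF M.M.ring_axioms N.M.ring_axioms])
  let ?I = "a_kernel M N h" and ?Q = "quot_algebra M (a_kernel M N h)"
  \<comment> \<open>On a coset of the kernel \<open>h\<close> is constant, so the image is a
    singleton and \<open>the_elem\<close> extracts the value of the induced map.\<close>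
  let ?f = "\<lambda>C. the_elem (h ` C)"
  have ideal: "ideal ?I M" by (rule h.kernel_is_ideal)
  have Q: "assoc_algebra R ?Q"
    by (rule assoc_algebra_quot_algebra[OF M ideal])
  interpret Q: assoc_algebra R ?Q by (rule Q)
  have f: "?f \<in> ring_iso ?Q N"
    using h.FactRing_iso_set[OF surj] by (simp add: ring_iso_def ring_hom_def quot_algebra_def)
  have carrier_Q: "carrier ?Q = (+>\<^bsub>M\<^esub>) ?I ` carrier M"
    by (auto simp: quot_algebra_def FactRing_def A_RCOSETS_def')
  \<comment> \<open>The induced isomorphism runs from the quotient to \<open>N\<close>, opposite to
    the one claimed. Its inverse sends \<open>h z\<close> to the coset of \<open>z\<close>, which
    makes it compatible with scalars.\<close>
  have "inv_into (carrier ?Q) ?f (c \<odot>\<^bsub>N\<^esub> y) = c \<odot>\<^bsub>?Q\<^esub> inv_into (carrier ?Q) ?f y"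
    if c: "c \<in> carrier R" and "y \<in> carrier N" for c y
  proof -
    from that surj obtain x where x: "x \<in> carrier M" "y = h x" by blast
    have inv: "inv_into (carrier ?Q) ?f (h z) = ?I +>\<^bsub>M\<^esub> z" if "z \<in> carrier M" for z
      using that ring_iso_memE(5)[OF f]
      by (intro inv_into_f_eq) (auto simp: bij_betw_def carrier_Q)
    show ?thesis
      using c x inv by (simp add: smult[symmetric] quot_algebra_smult[OF M ideal])
  qed
  with ring_iso_set_sym[OF Q.M.ring_axioms f] show ?thesis
    unfolding algebra_isomorphic_def using ideal Q N by blast
qed

section \<open>Shuffles\<close>

lemma shuffles_Nil2 [simp]: "shuffles xs [] = {xs}"
  by (cases xs) simp_all

lemma shuffles_map: "shuffles (map f xs) (map f ys) = map f ` shuffles xs ys"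
  by (induction xs ys rule: shuffles.induct) (simp_all add: image_Un image_image)

text \<open>Both sides are the shuffles of three words. Sorting them by their first letter, which
  comes from \<open>xs\<close>, \<open>ys\<close> or \<open>zs\<close>, leaves the same problem with
  one of the words shortened; hence the induction on total length.\<close>

lemma shuffles_assoc:
  "(\<Union>us\<in>shuffles xs ys. shuffles us zs) = (\<Union>us\<in>shuffles ys zs. shuffles xs us)"
proof (induction "length xs + length ys + length zs" arbitrary: xs ys zs rule: less_induct)
  case less
  show ?case
  proof (cases "xs = [] \<or> ys = [] \<or> zs = []")
    case True
    then show ?thesis by auto
  next
    case False
    then obtain x xs' y ys' z zs' where eq: "xs = x # xs'" "ys = y # ys'" "zs = z # zs'"
      by (meson list.exhaust)
    let ?L = "\<lambda>xs ys zs. \<Union>us\<in>shuffles xs ys. shuffles us zs"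
      and ?R = "\<lambda>xs ys zs. \<Union>us\<in>shuffles ys zs. shuffles xs us"
    have "?L xs ys zs = (#) x ` ?L xs' ys zs \<union> (#) y ` ?L xs ys' zs \<union> (#) z ` ?L xs ys zs'"
      by (simp add: eq UN_Un image_UN image_Un UN_Un_distrib Un_ac)
    also have "\<dots> = (#) x ` ?R xs' ys zs \<union> (#) y ` ?R xs ys' zs \<union> (#) z ` ?R xs ys zs'"
      using less[of xs' ys zs] less[of xs ys' zs] less[of xs ys zs'] by (simp add: eq)
    also have "\<dots> = ?R xs ys zs"
      by (simp add: eq UN_Un image_UN image_Un UN_Un_distrib Un_ac)
    finally show ?thesis .
  qed
qed

text \<open>Filtering commutes with shuffling and erases \<open>ys\<close>, so a factor can be
  recovered from the shuffle.\<close>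

lemma filter_shuffles_separated:
  assumes "zs \<in> shuffles xs ys" "\<And>x. x \<in> set xs \<Longrightarrow> P x" "\<And>y. y \<in> set ys \<Longrightarrow> \<not> P y"
  shows "filter P zs = xs"
proof -
  have "filter P zs \<in> shuffles (filter P xs) (filter P ys)"
    using assms(1) by (simp flip: filter_shuffles)
  moreover have "filter P xs = xs" "filter P ys = []"
    using assms(2,3) by (simp_all add: filter_empty_conv)
  ultimately show ?thesis by simp
qed

section \<open>Shifted shuffles of parking functions\<close>

lemma finite_shifted_shuffle [simp]: "finite (shifted_shuffle \<alpha> \<beta>)"
  by (simp add: shifted_shuffle_def)

lemma shifted_shuffle_Nil [simp]: "shifted_shuffle [] \<alpha> = {\<alpha>}" "shifted_shuffle \<alpha> [] = {\<alpha>}"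
  by (simp_all add: shifted_shuffle_def)

lemma length_shifted_shuffle: "\<gamma> \<in> shifted_shuffle \<alpha> \<beta> \<Longrightarrow> length \<gamma> = length \<alpha> + length \<beta>"
  by (simp add: shifted_shuffle_def length_shuffles)

text \<open>A letter at position i of the sorted word is at most i + 1, and i is below the
  length.\<close>

lemma PF_letter: "\<alpha> \<in> PF \<Longrightarrow> a \<in> set \<alpha> \<Longrightarrow> 0 < a \<and> a \<le> length \<alpha>"
proof -
  assume \<alpha>: "\<alpha> \<in> PF" and a: "a \<in> set \<alpha>"
  then obtain i where "i < length \<alpha>" "sort \<alpha> ! i = a"
    by (metis in_set_conv_nth length_sort set_sort)
  with \<alpha> a show ?thesis by (fastforce simp: PF_def)
qed

lemma PF_Nil [simp]: "[] \<in> PF"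
  by (simp add: PF_def)

text \<open>No letter of \<alpha> exceeds |\<alpha>| and no shifted letter of \<beta> is below it,
  so sorting \<gamma> gives sorted \<alpha> followed by shifted sorted \<beta>. In the second block
  positions and bounds both move by |\<alpha>|.\<close>

lemma shifted_shuffle_PF:
  assumes "\<alpha> \<in> PF" "\<beta> \<in> PF" "\<gamma> \<in> shifted_shuffle \<alpha> \<beta>"
  shows "\<gamma> \<in> PF"
proof -
  let ?\<beta> = "map (\<lambda>b. b + length \<alpha>) (sort \<beta>)"
  have "sort \<gamma> = sort \<alpha> @ ?\<beta>"
  proof (rule properties_for_sort)
    show "mset (sort \<alpha> @ ?\<beta>) = mset \<gamma>"
      using assms(3) by (simp add: shifted_shuffle_def mset_shuffles)
    show "sorted (sort \<alpha> @ ?\<beta>)"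
      using PF_letter[OF assms(1)] by (fastforce simp: sorted_append sorted_map intro: sorted_wrt_mono_rel[of _ "(\<le>)"])
  qed
  moreover have "0 < a" if "a \<in> set \<gamma>" for a
    using that assms by (auto simp: shifted_shuffle_def set_shuffles PF_def)
  moreover have "(sort \<alpha> @ ?\<beta>) ! i \<le> i + 1" if "i < length \<alpha> + length \<beta>" for i
  proof (cases "i < length \<alpha>")
    case True
    then show ?thesis using assms(1) by (simp add: PF_def nth_append)
  next
    case False
    with that have "i - length \<alpha> < length \<beta>" by simp
    with assms(2) have "sort \<beta> ! (i - length \<alpha>) \<le> i - length \<alpha> + 1"
      unfolding PF_def by blast
    with False \<open>i - length \<alpha> < length \<beta>\<close> show ?thesis
      by (simp add: nth_append)
  qed
  ultimately show ?thesis
    using length_shifted_shuffle[OF assms(3)] by (simp add: PF_def)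
qed

text \<open>The shift of \<gamma> depends on \<delta> only through its length |\<alpha>| +
  |\<beta>|, and shifting by this sum is shifting by |\<beta>| and then by |\<alpha>|. What remains
  is associativity of plain shuffles.\<close>

lemma shifted_shuffle_assoc:
  "(\<Union>\<delta>\<in>shifted_shuffle \<alpha> \<beta>. shifted_shuffle \<delta> \<gamma>) = (\<Union>\<delta>\<in>shifted_shuffle \<beta> \<gamma>. shifted_shuffle \<alpha> \<delta>)"
proof -
  let ?s = "\<lambda>n. map (\<lambda>b. b + n)"
  have "(\<Union>\<delta>\<in>shifted_shuffle \<alpha> \<beta>. shifted_shuffle \<delta> \<gamma>) =
      (\<Union>\<delta>\<in>shuffles \<alpha> (?s (length \<alpha>) \<beta>). shuffles \<delta> (?s (length \<alpha> + length \<beta>) \<gamma>))"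
    using length_shifted_shuffle[of _ \<alpha> \<beta>] by (simp add: shifted_shuffle_def)
  also have "\<dots> = (\<Union>\<delta>\<in>shuffles (?s (length \<alpha>) \<beta>) (?s (length \<alpha> + length \<beta>) \<gamma>). shuffles \<alpha> \<delta>)"
    by (rule shuffles_assoc)
  also have "?s (length \<alpha> + length \<beta>) \<gamma> = ?s (length \<alpha>) (?s (length \<beta>) \<gamma>)"
    by (simp add: comp_def add_ac)
  finally show ?thesis
    unfolding shuffles_map by (simp add: shifted_shuffle_def)
qed

lemma shifted_shuffle_filter:
  assumes "\<alpha> \<in> PF" "\<beta> \<in> PF" "\<gamma> \<in> shifted_shuffle \<alpha> \<beta>"
  shows "filter (\<lambda>x. x \<le> length \<alpha>) \<gamma> = \<alpha>"
    and "filter (\<lambda>x. length \<alpha> < x) \<gamma> = map (\<lambda>b. b + length \<alpha>) \<beta>"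
proof -
  have low: "x \<le> length \<alpha>" if "x \<in> set \<alpha>" for x
    using PF_letter[OF assms(1) that] by simp
  have high: "length \<alpha> < x" if "x \<in> set (map (\<lambda>b. b + length \<alpha>) \<beta>)" for x
    using that PF_letter[OF assms(2)] by auto
  show "filter (\<lambda>x. x \<le> length \<alpha>) \<gamma> = \<alpha>"
    using assms(3) unfolding shifted_shuffle_def
    by (rule filter_shuffles_separated) (simp_all only: low high not_le)
  show "filter (\<lambda>x. length \<alpha> < x) \<gamma> = map (\<lambda>b. b + length \<alpha>) \<beta>"
    using assms(3) unfolding shifted_shuffle_def shuffles_commutes[of \<alpha>]
    by (rule filter_shuffles_separated) (simp_all only: low high not_less)
qed

text \<open>The intermediate word \<open>\<delta>\<close> can be read off from the letters of \<open>\<epsilon>\<close>, so both unions in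
  \<open>shifted_shuffle_assoc\<close> are disjoint.\<close>

lemma sum_shifted_shuffle_assoc:
  fixes f :: "nat list \<Rightarrow> 'b :: comm_monoid_add"
  assumes "\<alpha> \<in> PF" "\<beta> \<in> PF" "\<gamma> \<in> PF"
  shows "(\<Sum>\<delta>\<in>shifted_shuffle \<alpha> \<beta>. \<Sum>\<epsilon>\<in>shifted_shuffle \<delta> \<gamma>. f \<epsilon>) =
    (\<Sum>\<delta>\<in>shifted_shuffle \<beta> \<gamma>. \<Sum>\<epsilon>\<in>shifted_shuffle \<alpha> \<delta>. f \<epsilon>)"
proof -
  \<comment> \<open>All \<delta> have the same length, and each is the subword of letters up to that
    length in any element of its shuffle set.\<close>
  have "shifted_shuffle \<delta> \<gamma> \<inter> shifted_shuffle \<delta>' \<gamma> = {}"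
    if "\<delta> \<in> shifted_shuffle \<alpha> \<beta>" "\<delta>' \<in> shifted_shuffle \<alpha> \<beta>" "\<delta> \<noteq> \<delta>'" for \<delta> \<delta>'
  proof -
    have "length \<delta> = length \<delta>'"
      using that by (simp add: length_shifted_shuffle)
    then show ?thesis
      using that assms by (metis disjoint_iff shifted_shuffle_PF shifted_shuffle_filter(1))
  qed
  then have "(\<Sum>\<delta>\<in>shifted_shuffle \<alpha> \<beta>. \<Sum>\<epsilon>\<in>shifted_shuffle \<delta> \<gamma>. f \<epsilon>) =
      (\<Sum>\<epsilon>\<in>(\<Union>\<delta>\<in>shifted_shuffle \<alpha> \<beta>. shifted_shuffle \<delta> \<gamma>). f \<epsilon>)"
    by (intro sum.UNION_disjoint[symmetric]) auto
  \<comment> \<open>Now the letters above |\<alpha>| spell \<delta> shifted by |\<alpha>|, and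
    shifting is injective.\<close>
  moreover have "shifted_shuffle \<alpha> \<delta> \<inter> shifted_shuffle \<alpha> \<delta>' = {}"
    if "\<delta> \<in> shifted_shuffle \<beta> \<gamma>" "\<delta>' \<in> shifted_shuffle \<beta> \<gamma>" "\<delta> \<noteq> \<delta>'" for \<delta> \<delta>'
  proof -
    have "\<delta> \<in> PF" "\<delta>' \<in> PF"
      using that assms by (blast intro: shifted_shuffle_PF)+
    moreover have "map (\<lambda>b. b + length \<alpha>) \<delta> \<noteq> map (\<lambda>b. b + length \<alpha>) \<delta>'"
      using that(3) by (simp add: inj_map_eq_map)
    ultimately show ?thesis
      using assms(1) by (metis disjoint_iff shifted_shuffle_filter(2))
  qed
  then have "(\<Sum>\<delta>\<in>shifted_shuffle \<beta> \<gamma>. \<Sum>\<epsilon>\<in>shifted_shuffle \<alpha> \<delta>. f \<epsilon>) =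
      (\<Sum>\<epsilon>\<in>(\<Union>\<delta>\<in>shifted_shuffle \<beta> \<gamma>. shifted_shuffle \<alpha> \<delta>). f \<epsilon>)"
    by (intro sum.UNION_disjoint[symmetric]) auto
  ultimately show ?thesis
    by (simp add: shifted_shuffle_assoc)
qed

section \<open>PQSym and its map onto the shifted shuffle algebra\<close>

lemma assoc_algebra_PQSym: "assoc_algebra Rats_ring PQSym"
  unfolding PQSym_def
proof (rule assoc_algebra_basis_algebra)
  fix \<alpha> \<beta> :: "nat list" assume "\<alpha> \<in> PF" "\<beta> \<in> PF"
  then show "Poly_Mapping.keys (\<Sum>\<gamma>\<in>shifted_shuffle \<alpha> \<beta>. basis_elt \<gamma>) \<subseteq> PF"
    by (intro keys_sum_subset) (auto intro: shifted_shuffle_PF)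
\<comment> \<open>Associativity on the basis is the double-sum identity; the unit laws hold because
  shuffling with the empty word leaves only the other word.\<close>
qed (simp_all add: lin_ext_sum sum_shifted_shuffle_assoc)

theorem proposition4p4:
  fixes st :: "nat list \<Rightarrow> 's"
  assumes "weakly_shuffle_compatible_PF st"
  shows "\<exists>I. ideal I PQSym \<and>
    algebra_isomorphic Rats_ring (shuffle_algebra_PF st) (quot_algebra PQSym I)"
proof -
  let ?A = "shuffle_algebra_PF st" and ?f = "PF_class st"
  define \<phi> where "\<phi> = lin_ext (\<lambda>\<alpha>. basis_elt (?f \<alpha>))"
  \<comment> \<open>Weak shuffle-compatibility enters here: it allows the product of two classes to
    be computed with \<alpha> and \<beta> themselves, so both sides become the sum of the classes of
    their shifted shuffles.\<close>
  have hom: "\<phi> \<in> ring_hom PQSym ?A"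
    unfolding \<phi>_def PQSym_def shuffle_algebra_PF_def
    by (rule lin_ext_ring_hom)
      (auto simp: lin_ext_sum shuffle_algebra_PF_mult_class[OF assms, symmetric, unfolded shuffle_algebra_PF_def])
  have smult: "\<phi> (c \<odot>\<^bsub>PQSym\<^esub> x) = c \<odot>\<^bsub>?A\<^esub> \<phi> x" for c x
    by (simp add: \<phi>_def PQSym_def shuffle_algebra_PF_def basis_algebra_simps lin_ext_scale)
  have zero: "\<phi> \<zero>\<^bsub>PQSym\<^esub> = \<zero>\<^bsub>?A\<^esub>"
    by (simp add: \<phi>_def PQSym_def shuffle_algebra_PF_def basis_algebra_simps)
  have surj: "\<phi> ` carrier PQSym = carrier ?A"
    unfolding \<phi>_def PQSym_def shuffle_algebra_PF_def basis_algebra_simps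
    by (rule lin_ext_image)
  have "assoc_algebra Rats_ring ?A"
    using assoc_algebra_hom_image[OF assoc_algebra_PQSym hom smult zero surj] by blast
  from first_isomorphism[OF assoc_algebra_PQSym this hom smult surj] show ?thesis
    by blast
qed

end
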